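(* Let $b\ge 1$ be a fixed integer, fix $r\in\{1,\ldots,b\}$ and $\alpha\in(0,1)$, and let $s=s(n)$ be integers with $s=\alpha n+o(n)$ as $n\to\infty$. Let $P^{(n)}_{\rm SLP}(\pi(s,r))$ be the winning probability of the single-level policy $\pi(s,r)$ with $n$ objects. Then $$\lim_{n\to\infty} P_{\rm SLP}^{(n)}(\pi(s,r)) = \alpha^r\int_\alpha^1\frac{1}{x^r}\left( r + \sum_{j=r+1}^b\sum_{k=1}^r \binom{j-1}{k-1}x^{k-1}(1-x)^{j-k}\right)dx.$$
   Context: $n$ objects (with $n\ge b$) arrive one by one in uniformly random order. $X_i\in\{1,\ldots,n\}$ is the absolute rank of the $i$-th arriving object (rank 1 is best), so $(X_1,\ldots,X_n)$ is a uniformly random permutation of $\{1,\ldots,n\}$. $Y_i=\#\{k\le i: X_k\le X_i\}$ is the relative rank of the $i$-th object among the first $i$ objects. Single-level policy $\pi(s,r)$ (position threshold $0\le s\le n-1$, rank level $1\le r\le b$): no object at positions $1,\ldots,s$ is picked; the first object at a position $i\in\{s+1,\ldots,n-1\}$ with $Y_i\le r$ is picked; if there is no such object, the last object (position $n$) is picked, whatever its rank. The policy wins if the picked object, at position $i$, has $X_i\le b$ (it is one of the $b$ best). $P^{(n)}_{\rm SLP}(\pi(s,r))$ is the probability of winning. Since $0<\alpha<1$, the condition $0\le s(n)\le n-1$ holds for all large $n$. Empty sums are zero. *)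

theory Defs
  imports
    "HOL-Probability.Probability"
    "HOL-Combinatorics.Combinatorics"
    "HOL-Library.Landau_Symbols"
begin

text \<open>
  An arrival order of \<open>n\<close> objects is a permutation \<open>X\<close> of \<open>{1..n}\<close>: \<open>X i\<close> is the absolute rank
  (1 is best) of the object arriving at position \<open>i\<close>.
\<close>

definition arrival_pmf :: "nat \<Rightarrow> (nat \<Rightarrow> nat) pmf" where
  "arrival_pmf n = pmf_of_set {X. X permutes {1..n}}"

definition relative_rank :: "(nat \<Rightarrow> nat) \<Rightarrow> nat \<Rightarrow> nat" where
  "relative_rank X i = card {k \<in> {1..i}. X k \<le> X i}"

definition slp_pick :: "nat \<Rightarrow> nat \<Rightarrow> nat \<Rightarrow> (nat \<Rightarrow> nat) \<Rightarrow> nat" where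
  "slp_pick n s r X =
     (if \<exists>i\<in>{s+1..n-1}. relative_rank X i \<le> r
      then LEAST i. i \<in> {s+1..n-1} \<and> relative_rank X i \<le> r
      else n)"

definition slp_win_prob :: "nat \<Rightarrow> nat \<Rightarrow> nat \<Rightarrow> nat \<Rightarrow> real" where
  "slp_win_prob b n s r =
     measure_pmf.prob (arrival_pmf n) {X. X (slp_pick n s r X) \<le> b}"

end

theory Submission
  imports Defs
begin

text \<open>
  Split the winning event according to the selected position \<open>i\<close> and the absolute rank \<open>j \<le> b\<close> found
  there. Selecting at \<open>i < n\<close> means that \<open>i\<close> has relative rank at most \<open>r\<close> while no position
  in \<open>{s+1..i-1}\<close> has. For \<open>r \<le> s < i\<close> the second condition says that the \<open>r\<close> best of the first \<open>i - 1\<close>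
  objects all lie among the first \<open>s\<close> (\<open>no_candidate_iff_top_positions\<close>). Shuffling the first
  \<open>i - 1\<close> positions changes neither the rank at \<open>i\<close> nor the relative rank there, but moves these \<open>r\<close> best
  positions transitively over all \<open>r\<close>-subsets. Hence, given the first condition, they
  are uniformly distributed, and the second one has conditional probability
  \<open>(s choose r) / (i - 1 choose r)\<close>, which tends to \<open>(\<alpha> / x) ^ r\<close> when \<open>i / n\<close> tends to \<open>x\<close>.

  The same symmetry gives the rest of the law. The position of rank \<open>j\<close> is uniform, and
  given that it is \<open>i\<close>, the set of the \<open>j - 1\<close> positions of better objects is uniform among the subsets
  of the other \<open>n - 1\<close> positions. The relative rank at \<open>i\<close> is \<open>k\<close> iff exactly \<open>k - 1\<close> of them come before
  \<open>i\<close>, which is hypergeometric and tends to the binomial weight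
  \<open>(j - 1 choose (k - 1)) * x ^ (k - 1) * (1 - x) ^ (j - k)\<close>. For \<open>j \<le> r\<close> these weights exhaust
  everything and sum to 1, and the \<open>r\<close> such ranks give the summand \<open>r\<close> of the integrand. All three
  uses of symmetry are instances of \<open>card_equivariant_subset\<close>.

  Winning at the last position requires an object of rank at most \<open>b\<close> there, so this costs at
  most \<open>b / n\<close>. The rest is \<open>1 / n\<close> times a sum over \<open>s < i < n\<close> of uniformly bounded weights, that is,
  the integral of a step function over the unit interval (\<open>riemann_sum_tendsto\<close>), and dominated
  convergence turns the pointwise limit of the weights into the limit of the probabilities.
\<close>

section \<open>Uniformity from symmetry\<close>

lemma permutation_between_equicardinal_subsets:
  fixes V :: "'a set"
  assumes fin: "finite V" and S: "S \<subseteq> V" and S': "S' \<subseteq> V" and card: "card S = card S'"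
  obtains \<tau> where "\<tau> permutes V" and "\<tau> ` S' = S"
proof -
  have fS: "finite S" "finite S'" using fin S S' finite_subset by auto
  obtain f where f: "bij_betw f S' S"
    using fS card by (metis finite_same_card_bij)
  have "card (V - S') = card (V - S)"
    using S S' fS card by (simp add: card_Diff_subset)
  then obtain g where g: "bij_betw g (V - S') (V - S)"
    using fin by (meson finite_Diff finite_same_card_bij)
  define \<tau> where "\<tau> x = (if x \<in> S' then f x else if x \<in> V then g x else x)" for x
  have 1: "bij_betw \<tau> S' S"
    using f by (rule bij_betw_cong[THEN iffD1, rotated]) (simp add: \<tau>_def)
  have 2: "bij_betw \<tau> (V - S') (V - S)"
    using g by (rule bij_betw_cong[THEN iffD1, rotated]) (simp add: \<tau>_def)
  have "bij_betw \<tau> (S' \<union> (V - S')) (S \<union> (V - S))"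
    using 1 2 by (rule bij_betw_combine) blast
  moreover have "S' \<union> (V - S') = V" "S \<union> (V - S) = V" using S S' by auto
  ultimately have "bij_betw \<tau> V V" by simp
  moreover have "\<tau> x = x" if "x \<notin> V" for x using that S' by (auto simp: \<tau>_def)
  ultimately have "\<tau> permutes V" by (rule bij_imp_permutes)
  moreover have "\<tau> ` S' = S" using 1 by (simp add: bij_betw_def)
  ultimately show thesis by (rule that)
qed

text \<open>
  If shuffling the arguments of the functions in \<open>A\<close> by a permutation of \<open>V\<close> carries the random \<open>k\<close>-subset
  \<open>F X\<close> along, then \<open>F X\<close> is uniformly distributed: permutations of \<open>V\<close> act transitively on the
  \<open>k\<close>-subsets, so all fibres of \<open>F\<close> have the same size. The statement is kept free of division.
\<close>

lemma card_equivariant_subset: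
  fixes A :: "('a \<Rightarrow> 'b) set" and V :: "'a set"
  assumes finA: "finite A" and finV: "finite V"
    and F: "\<And>X. X \<in> A \<Longrightarrow> F X \<subseteq> V \<and> card (F X) = k"
    and closed: "\<And>X \<tau>. X \<in> A \<Longrightarrow> \<tau> permutes V \<Longrightarrow> X \<circ> \<tau> \<in> A"
    and equivariant: "\<And>X \<tau>. X \<in> A \<Longrightarrow> \<tau> permutes V \<Longrightarrow> \<tau> ` F (X \<circ> \<tau>) = F X"
    and U: "U \<subseteq> {S. S \<subseteq> V \<and> card S = k}"
  shows "card {X \<in> A. F X \<in> U} * (card V choose k) = card A * card U"
proof -
  let ?K = "{S. S \<subseteq> V \<and> card S = k}"
  define c where "c S = card {X \<in> A. F X = S}" for S
  have finK: "finite ?K" using finV by simp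
  \<comment> \<open>A permutation that carries \<open>S'\<close> to \<open>S\<close> embeds the fibre over \<open>S\<close> into the one over \<open>S'\<close>.\<close>
  have le: "c S \<le> c S'" if "S \<in> ?K" "S' \<in> ?K" for S S'
  proof -
    obtain \<tau> where \<tau>: "\<tau> permutes V" "\<tau> ` S' = S"
      using permutation_between_equicardinal_subsets[OF finV, of S S'] \<open>S \<in> ?K\<close> \<open>S' \<in> ?K\<close> by auto
    have "inj_on (\<lambda>X. X \<circ> \<tau>) {X \<in> A. F X = S}"
    proof (rule inj_onI)
      fix X X' :: "'a \<Rightarrow> 'b" assume "X \<circ> \<tau> = X' \<circ> \<tau>"
      then show "X = X'" using permutes_surj[OF \<tau>(1)] by (metis surj_fun_eq)
    qed
    moreover have "(\<lambda>X. X \<circ> \<tau>) ` {X \<in> A. F X = S} \<subseteq> {X \<in> A. F X = S'}"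
    proof safe
      fix X assume X: "X \<in> A" "S = F X"
      show "X \<circ> \<tau> \<in> A" using closed X \<tau> by simp
      have "\<tau> ` F (X \<circ> \<tau>) = \<tau> ` S'" using equivariant[OF X(1) \<tau>(1)] \<tau>(2) X by simp
      then have eq: "F (X \<circ> \<tau>) = S'"
        using permutes_inj[OF \<tau>(1)] by (simp add: inj_image_eq_iff)
      show "\<And>x. x \<in> F (X \<circ> \<tau>) \<Longrightarrow> x \<in> S'" "\<And>x. x \<in> S' \<Longrightarrow> x \<in> F (X \<circ> \<tau>)"
        using eq by auto
    qed
    ultimately show ?thesis
      unfolding c_def using finA by (intro card_inj_on_le) auto
  qed
  have count: "card {X \<in> A. F X \<in> W} = (\<Sum>S\<in>W. c S)" if "W \<subseteq> ?K" for W
  proof -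
    have "finite W" using that finK finite_subset by blast
    have "{X \<in> A. F X \<in> W} = (\<Union>S\<in>W. {X \<in> A. F X = S})" by auto
    then show ?thesis unfolding c_def
      using finA \<open>finite W\<close> by (simp add: card_UN_disjoint disjoint_iff)
  qed
  have A: "card A = (\<Sum>S\<in>?K. c S)"
  proof -
    have "{X \<in> A. F X \<in> ?K} = A" using F by blast
    then show ?thesis using count[of ?K] by simp
  qed
  show ?thesis
  proof (cases "U = {}")
    case False
    then obtain S0 where "S0 \<in> U" by auto
    with U have S0: "S0 \<in> ?K" by auto
    have c: "c S = c S0" if "S \<in> ?K" for S using le that S0 by (meson le_antisym)
    have "card A = card ?K * c S0" unfolding A using c by simp
    moreover have "card {X \<in> A. F X \<in> U} = card U * c S0"
      unfolding count[OF U] using c U by (simp add: subset_iff)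
    ultimately show ?thesis using n_subsets[OF finV, of k] by simp
  qed simp
qed

section \<open>Relative order within a set of positions\<close>

definition rank_in :: "'a set \<Rightarrow> ('a \<Rightarrow> nat) \<Rightarrow> 'a \<Rightarrow> nat" where
  "rank_in V X p = card {q \<in> V. X q \<le> X p}"

definition top_positions :: "nat \<Rightarrow> 'a set \<Rightarrow> ('a \<Rightarrow> nat) \<Rightarrow> 'a set" where
  "top_positions r V X = {p \<in> V. rank_in V X p \<le> r}"

lemma relative_rank_eq_rank_in: "relative_rank X i = rank_in {1..i} X i"
  by (simp add: relative_rank_def rank_in_def)

lemma rank_in_comp:
  assumes "\<tau> permutes V"
  shows "rank_in V (X \<circ> \<tau>) p = rank_in V X (\<tau> p)"
proof -
  have "\<tau> ` {q \<in> V. X (\<tau> q) \<le> X (\<tau> p)} = {q \<in> V. X q \<le> X (\<tau> p)}"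
  proof safe
    fix q assume "q \<in> V" "X q \<le> X (\<tau> p)"
    then show "q \<in> \<tau> ` {q \<in> V. X (\<tau> q) \<le> X (\<tau> p)}"
      using assms by (intro image_eqI[of _ _ "inv \<tau> q"])
        (auto simp: permutes_inverses permutes_in_image permutes_inv)
  qed (use assms in \<open>auto simp: permutes_in_image\<close>)
  moreover have "inj_on \<tau> {q \<in> V. X (\<tau> q) \<le> X (\<tau> p)}"
    using assms by (meson permutes_inj inj_on_subset subset_UNIV)
  ultimately have "card {q \<in> V. X q \<le> X (\<tau> p)} = card {q \<in> V. X (\<tau> q) \<le> X (\<tau> p)}"
    using card_image by fastforce
  then show ?thesis by (simp add: rank_in_def)
qed

lemma top_positions_comp:
  assumes "\<tau> permutes V"
  shows "\<tau> ` top_positions r V (X \<circ> \<tau>) = top_positions r V X"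
proof safe
  fix p assume "p \<in> top_positions r V (X \<circ> \<tau>)"
  then show "\<tau> p \<in> top_positions r V X"
    using assms by (simp add: top_positions_def rank_in_comp permutes_in_image)
next
  fix p assume "p \<in> top_positions r V X"
  then show "p \<in> \<tau> ` top_positions r V (X \<circ> \<tau>)"
    using assms by (intro image_eqI[of _ _ "inv \<tau> p"])
      (auto simp: top_positions_def rank_in_comp permutes_inverses permutes_in_image permutes_inv)
qed

lemma rank_in_less_iff:
  assumes "finite V" "p \<in> V" "q \<in> V"
  shows "rank_in V X p < rank_in V X q \<longleftrightarrow> X p < X q"
proof -
  have mono: "rank_in V X p \<le> rank_in V X q" if "X p \<le> X q" for p q
    unfolding rank_in_def using assms(1) that by (intro card_mono) auto
  have "rank_in V X p < rank_in V X q" if "X p < X q"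
    unfolding rank_in_def
  proof (rule psubset_card_mono)
    have "q \<in> {u \<in> V. X u \<le> X q}" "q \<notin> {u \<in> V. X u \<le> X p}" using that assms(3) by auto
    moreover have "{u \<in> V. X u \<le> X p} \<subseteq> {u \<in> V. X u \<le> X q}" using that by auto
    ultimately show "{u \<in> V. X u \<le> X p} \<subset> {u \<in> V. X u \<le> X q}" by blast
  qed (use assms in simp)
  then show ?thesis using mono[of q p] by linarith
qed

text \<open>
  The ranks within \<open>V\<close> are distinct and lie in \<open>{1..card V}\<close>, hence attain each value there exactly once.
\<close>

lemma card_top_positions:
  assumes fin: "finite V" and inj: "inj_on X V" and r: "r \<le> card V"
  shows "card (top_positions r V X) = r"
proof -
  have injr: "inj_on (rank_in V X) V"
  proof (rule inj_onI)
    fix p q assume pq: "p \<in> V" "q \<in> V" "rank_in V X p = rank_in V X q"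
    then have "X p = X q"
      using rank_in_less_iff[OF fin, of p q X] rank_in_less_iff[OF fin, of q p X] by linarith
    then show "p = q" using inj pq by (simp add: inj_on_eq_iff)
  qed
  have "rank_in V X ` V \<subseteq> {1..card V}"
  proof safe
    fix p assume "p \<in> V"
    then have "{q \<in> V. X q \<le> X p} \<noteq> {}" by auto
    then have "rank_in V X p \<noteq> 0" using fin by (simp add: rank_in_def)
    moreover have "rank_in V X p \<le> card V"
      unfolding rank_in_def using fin by (intro card_mono) auto
    ultimately show "rank_in V X p \<in> {1..card V}" by simp
  qed
  moreover have "card (rank_in V X ` V) = card V" using injr by (rule card_image)
  ultimately have img: "rank_in V X ` V = {1..card V}" by (intro card_subset_eq) auto
  have "rank_in V X ` top_positions r V X = {1..r}"
  proof
    show "rank_in V X ` top_positions r V X \<subseteq> {1..r}"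
      using img by (auto simp: top_positions_def)
    show "{1..r} \<subseteq> rank_in V X ` top_positions r V X"
    proof
      fix y assume y: "y \<in> {1..r}"
      then have "y \<in> rank_in V X ` V" using img r by auto
      then show "y \<in> rank_in V X ` top_positions r V X"
        using y by (auto simp: top_positions_def)
    qed
  qed
  moreover have "inj_on (rank_in V X) (top_positions r V X)"
    using injr by (rule inj_on_subset) (auto simp: top_positions_def)
  ultimately show ?thesis using card_image by fastforce
qed

text \<open>
  A position after \<open>s\<close> holding one of the \<open>r\<close> best of the first \<open>m\<close> objects has relative rank at most \<open>r\<close>
  on arrival. Conversely, when the \<open>r\<close> best all sit at the start, every later object is preceded
  by \<open>r\<close> better ones. This turns the waiting condition of the policy into an event about
  one random \<open>r\<close>-subset, to which symmetry applies.
\<close>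

lemma no_candidate_iff_top_positions:
  fixes X :: "nat \<Rightarrow> nat"
  assumes inj: "inj_on X {1..m}" and "r \<le> s" "s \<le> m"
  shows "(\<forall>k\<in>{s+1..m}. r < relative_rank X k) \<longleftrightarrow> top_positions r {1..m} X \<subseteq> {1..s}"
proof
  assume none: "\<forall>k\<in>{s+1..m}. r < relative_rank X k"
  show "top_positions r {1..m} X \<subseteq> {1..s}"
  proof
    fix p assume p: "p \<in> top_positions r {1..m} X"
    then have pm: "p \<in> {1..m}" by (simp add: top_positions_def)
    have "relative_rank X p \<le> rank_in {1..m} X p"
      unfolding relative_rank_def rank_in_def using pm by (intro card_mono) auto
    with p have "relative_rank X p \<le> r" by (simp add: top_positions_def)
    with none pm show "p \<in> {1..s}" by (metis Suc_eq_plus1 atLeastAtMost_iff not_less not_less_eq_eq)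
  qed
next
  assume top: "top_positions r {1..m} X \<subseteq> {1..s}"
  show "\<forall>k\<in>{s+1..m}. r < relative_rank X k"
  proof
    fix k assume k: "k \<in> {s+1..m}"
    let ?T = "top_positions r {1..m} X"
    have kT: "k \<notin> ?T" using top k by auto
    then have rk: "r < rank_in {1..m} X k" using k by (auto simp: top_positions_def)
    have "insert k ?T \<subseteq> {q \<in> {1..k}. X q \<le> X k}"
    proof safe
      fix p assume p: "p \<in> ?T"
      then show "p \<in> {1..k}" using top k by auto
      have "rank_in {1..m} X p < rank_in {1..m} X k" using p rk by (simp add: top_positions_def)
      then show "X p \<le> X k"
        using rank_in_less_iff[of "{1..m}" p k X] p k by (simp add: top_positions_def)
    qed (use k in auto)
    then have "card (insert k ?T) \<le> relative_rank X k"
      unfolding relative_rank_def by (intro card_mono) auto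
    moreover have "card (insert k ?T) = Suc r"
      using kT card_top_positions[OF _ inj, of r] assms finite_subset[OF top] by simp
    ultimately show "r < relative_rank X k" by simp
  qed
qed

section \<open>Counting arrival orders\<close>

lemma card_fixed_rank:
  assumes "i \<in> {1..n}"  "j \<in> {1..n}"
  shows "card {X. X permutes {1..n} \<and> X i = j} * n = fact n"
proof -
  let ?A = "{X. X permutes {1..n}}"
  have "card {X \<in> ?A. {p. X p = j} \<in> {{i}}} * (card {1..n} choose 1) = card ?A * card {{i}}"
  proof (rule card_equivariant_subset)
    fix X :: "nat \<Rightarrow> nat" assume X: "X \<in> ?A"
    then have pre: "{p. X p = j} = {inv X j}" by (auto simp: permutes_inverses)
    then show "{p. X p = j} \<subseteq> {1..n} \<and> card {p. X p = j} = 1"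
      using X assms permutes_in_image[OF permutes_inv, of X "{1..n}" j] by simp
    fix \<tau> assume \<tau>: "\<tau> permutes {1..n}"
    show "X \<circ> \<tau> \<in> ?A" using X \<tau> by (simp add: permutes_compose)
    show "\<tau> ` {p. (X \<circ> \<tau>) p = j} = {p. X p = j}"
    proof (intro equalityI subsetI)
      fix p assume "p \<in> {p. X p = j}"
      then show "p \<in> \<tau> ` {p. (X \<circ> \<tau>) p = j}"
        using \<tau> by (intro image_eqI[of _ _ "inv \<tau> p"]) (auto simp: permutes_inverses)
    qed auto
  qed (use assms in \<open>auto simp: finite_permutations\<close>)
  moreover have "{X \<in> ?A. {p. X p = j} \<in> {{i}}} = {X. X permutes {1..n} \<and> X i = j}"
  proof (intro equalityI subsetI)
    fix X assume X: "X \<in> {X. X permutes {1..n} \<and> X i = j}"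
    then have "p = i" if "X p = j" for p
    proof -
      have "X p = X i" using that X by simp
      moreover have "inj X" using X permutes_inj by blast
      ultimately show "p = i" by (simp only: inj_eq)
    qed
    then have "{p. X p = j} = {i}" using X by blast
    then show "X \<in> {X \<in> ?A. {p. X p = j} \<in> {{i}}}" using X by simp
  qed auto
  ultimately show ?thesis by (simp add: card_permutations)
qed

lemma card_subsets_with_intersection:
  assumes "finite P" "finite Q" "P \<inter> Q = {}" "y \<le> k"
  shows "card {S. S \<subseteq> P \<union> Q \<and> card S = k \<and> card (S \<inter> P) = y}
         = (card P choose y) * (card Q choose (k - y))"
proof -
  let ?L = "{S. S \<subseteq> P \<union> Q \<and> card S = k \<and> card (S \<inter> P) = y}"
  let ?R = "{S. S \<subseteq> P \<and> card S = y} \<times> {S. S \<subseteq> Q \<and> card S = k - y}"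
  have "bij_betw (\<lambda>(S, S'). S \<union> S') ?R ?L"
  proof (rule bij_betwI[where g = "\<lambda>S. (S \<inter> P, S \<inter> Q)"])
    show "(\<lambda>(S, S'). S \<union> S') \<in> ?R \<rightarrow> ?L"
    proof safe
      fix S S' assume *: "S \<subseteq> P" "S' \<subseteq> Q" "card S' = k - card S" "y = card S"
      then have fin: "finite S" "finite S'" using assms finite_subset by auto
      have disj: "S \<inter> S' = {}" "(S \<union> S') \<inter> P = S" using * assms by auto
      show "card (S \<union> S') = k" using card_Un_disjoint[OF fin disj(1)] * assms by simp
      show "card ((S \<union> S') \<inter> P) = card S" using disj by simp
    qed auto
    show "(\<lambda>S. (S \<inter> P, S \<inter> Q)) \<in> ?L \<rightarrow> ?R"
    proof safe
      fix S assume *: "S \<subseteq> P \<union> Q" "y = card (S \<inter> P)" "k = card S"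
      have "card ((S \<inter> P) \<union> (S \<inter> Q)) = card (S \<inter> P) + card (S \<inter> Q)"
        using assms by (intro card_Un_disjoint) auto
      moreover have "(S \<inter> P) \<union> (S \<inter> Q) = S" using * by blast
      ultimately have "card S = card (S \<inter> P) + card (S \<inter> Q)" by simp
      then show "card (S \<inter> Q) = card S - card (S \<inter> P)" by simp
    qed
    show "\<And>x. x \<in> ?R \<Longrightarrow> (\<lambda>S. (S \<inter> P, S \<inter> Q)) ((\<lambda>(S, S'). S \<union> S') x) = x"
      using assms by auto
    show "\<And>S. S \<in> ?L \<Longrightarrow> (\<lambda>(S, S'). S \<union> S') ((\<lambda>S. (S \<inter> P, S \<inter> Q)) S) = S" by auto
  qed
  then have "card ?L = card ?R" by (simp add: bij_betw_same_card)
  then show ?thesis using assms by (simp add: card_cartesian_product n_subsets)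
qed

text \<open>
  When position \<open>i\<close> holds rank \<open>j\<close>, the set of positions holding ranks below \<open>j\<close> is a uniform \<open>(j - 1)\<close>-subset of the positions other
  than \<open>i\<close>, and the relative rank of \<open>i\<close> exceeds by one the number of these positions before \<open>i\<close>.
\<close>

lemma card_fixed_rank_candidate:
  assumes i: "i \<in> {1..n}" and j: "j \<in> {1..n}"
  shows "card {X. X permutes {1..n} \<and> X i = j \<and> relative_rank X i \<le> r} * (n - 1 choose (j - 1))
       = card {X. X permutes {1..n} \<and> X i = j}
         * card {S. S \<subseteq> {1..n} - {i} \<and> card S = j - 1 \<and> card (S \<inter> {1..<i}) < r}"
proof -
  let ?A = "{X. X permutes {1..n} \<and> X i = j}"
  let ?U = "{S. S \<subseteq> {1..n} - {i} \<and> card S = j - 1 \<and> card (S \<inter> {1..<i}) < r}"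
  let ?F = "\<lambda>X. {p \<in> {1..n}. X p < j}"
  have FX: "?F X \<subseteq> {1..n} - {i} \<and> card (?F X) = j - 1" if X: "X \<in> ?A" for X
  proof
    show "?F X \<subseteq> {1..n} - {i}" using X by auto
    have perm: "X permutes {1..n}" using X by simp
    have "X ` ?F X = {1..<j}"
    proof safe
      fix y assume y: "y \<in> {1..<j}"
      then have "y \<in> {1..n}" using j by auto
      then have "inv X y \<in> {1..n}" using permutes_in_image[OF permutes_inv[OF perm]] by blast
      then show "y \<in> X ` ?F X" using y perm
        by (intro image_eqI[of _ _ "inv X y"]) (auto simp: permutes_inverses)
    next
      fix p assume "p \<in> {1..n}" "X p < j"
      then show "X p \<in> {1..<j}" using permutes_in_image[OF perm, of p] by auto
    qed
    moreover have "inj_on X (?F X)" using permutes_inj[OF perm] by (rule inj_on_subset) simp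
    ultimately show "card (?F X) = j - 1" using card_image by fastforce
  qed
  have "card {X \<in> ?A. ?F X \<in> ?U} * (card ({1..n} - {i}) choose (j - 1)) = card ?A * card ?U"
  proof (rule card_equivariant_subset)
    fix X \<tau> assume X: "X \<in> ?A" and \<tau>: "\<tau> permutes {1..n} - {i}"
    then have \<tau>n: "\<tau> permutes {1..n}" by (meson Diff_subset permutes_subset)
    have \<tau>i: "\<tau> i = i" using \<tau> by (simp add: permutes_not_in)
    show "X \<circ> \<tau> \<in> ?A" using X \<tau>n \<tau>i by (simp add: permutes_compose)
    show "\<tau> ` ?F (X \<circ> \<tau>) = ?F X"
    proof safe
      fix p assume p: "p \<in> {1..n}" "X p < j"
      then have "inv \<tau> p \<in> {1..n}" using permutes_in_image[OF permutes_inv[OF \<tau>n]] by blast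
      then show "p \<in> \<tau> ` ?F (X \<circ> \<tau>)" using p \<tau>
        by (intro image_eqI[of _ _ "inv \<tau> p"]) (auto simp: permutes_inverses)
    qed (use permutes_in_image[OF \<tau>n] in auto)
  next
    show "finite ?A" by (rule finite_subset[OF _ finite_permutations[of "{1..n}"]]) auto
  qed (use FX in auto)
  moreover have "{X \<in> ?A. ?F X \<in> ?U}
      = {X. X permutes {1..n} \<and> X i = j \<and> relative_rank X i \<le> r}"
  proof -
    have "relative_rank X i \<le> r \<longleftrightarrow> ?F X \<in> ?U" if X: "X \<in> ?A" for X
    proof -
      have inj: "inj X" using X permutes_inj by auto
      have "{k \<in> {1..i}. X k \<le> X i} = insert i (?F X \<inter> {1..<i})"
      proof (intro equalityI subsetI)
        fix k assume k: "k \<in> {k \<in> {1..i}. X k \<le> X i}"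
        have "X k < j" if "k \<noteq> i"
        proof -
          have "X k \<noteq> X i" using that inj by (simp only: inj_eq not_False_eq_True)
          then show ?thesis using k X by simp
        qed
        then show "k \<in> insert i (?F X \<inter> {1..<i})" using k i by auto
      qed (use X i in auto)
      then have "relative_rank X i = Suc (card (?F X \<inter> {1..<i}))"
        by (simp add: relative_rank_def)
      then show ?thesis using FX[OF X] by auto
    qed
    then show ?thesis by blast
  qed
  ultimately show ?thesis using i by simp
qed

definition select_at :: "nat \<Rightarrow> nat \<Rightarrow> nat \<Rightarrow> nat \<Rightarrow> nat \<Rightarrow> (nat \<Rightarrow> nat) set" where
  "select_at n s r i j = {X. X permutes {1..n} \<and> X i = j \<and> relative_rank X i \<le> r
      \<and> (\<forall>k\<in>{s+1..i-1}. r < relative_rank X k)}"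

text \<open>
  Permuting the first \<open>i - 1\<close> positions preserves the rank and the relative rank at \<open>i\<close>, so under these
  constraints the positions of the \<open>r\<close> best earlier objects still form a uniform \<open>r\<close>-subset. This
  is the independence of the waiting condition from what is found at \<open>i\<close>.
\<close>

lemma card_select_at:
  assumes i: "i \<in> {1..n}" and rs: "r \<le> s" "s < i"
  shows "card (select_at n s r i j) * (i - 1 choose r)
       = card {X. X permutes {1..n} \<and> X i = j \<and> relative_rank X i \<le> r} * (s choose r)"
proof -
  let ?A = "{X. X permutes {1..n} \<and> X i = j \<and> relative_rank X i \<le> r}"
  let ?V = "{1..i-1}"
  let ?U = "{S. S \<subseteq> {1..s} \<and> card S = r}"
  have inj: "inj_on X W" if "X permutes {1..n}" for X and W
    using permutes_inj[OF that] by (rule inj_on_subset) simp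
  have top: "top_positions r ?V X \<subseteq> ?V \<and> card (top_positions r ?V X) = r" if "X \<in> ?A" for X
    using card_top_positions[of ?V X r] inj that rs by (auto simp: top_positions_def)
  have "card {X \<in> ?A. top_positions r ?V X \<in> ?U} * (card ?V choose r) = card ?A * card ?U"
  proof (rule card_equivariant_subset[OF _ _ top])
    fix X \<tau> assume X: "X \<in> ?A" and \<tau>: "\<tau> permutes ?V"
    have \<tau>n: "\<tau> permutes {1..n}" using i by (intro permutes_subset[OF \<tau>]) auto
    have \<tau>i: "\<tau> permutes {1..i}" by (intro permutes_subset[OF \<tau>]) auto
    have "i \<notin> ?V" using i by auto
    then have fix_i: "\<tau> i = i" by (rule permutes_not_in[OF \<tau>])
    have "relative_rank (X \<circ> \<tau>) i = relative_rank X i"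
      unfolding relative_rank_eq_rank_in rank_in_comp[OF \<tau>i] fix_i ..
    then show "X \<circ> \<tau> \<in> ?A" using X \<tau>n fix_i by (simp add: permutes_compose)
    show "\<tau> ` top_positions r ?V (X \<circ> \<tau>) = top_positions r ?V X"
      by (rule top_positions_comp[OF \<tau>])
  next
    show "finite ?A" by (rule finite_subset[OF _ finite_permutations[of "{1..n}"]]) auto
    show "?U \<subseteq> {S. S \<subseteq> ?V \<and> card S = r}" using rs by fastforce
  qed auto
  moreover have "{X \<in> ?A. top_positions r ?V X \<in> ?U} = select_at n s r i j"
  proof -
    have "(\<forall>k\<in>{s+1..i-1}. r < relative_rank X k) \<longleftrightarrow> top_positions r ?V X \<in> ?U" if "X \<in> ?A" for X
      using no_candidate_iff_top_positions[of X "i-1" r s] inj top[OF that] that rs by auto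
    then show ?thesis unfolding select_at_def by blast
  qed
  ultimately show ?thesis by (simp add: n_subsets)
qed

lemma finite_select_at: "finite (select_at n s r i j)"
  by (rule finite_subset[OF _ finite_permutations[of "{1..n}"]]) (auto simp: select_at_def)

text \<open>
  The factor \<open>n\<close> compensates for the probability \<open>1 / n\<close> of finding rank \<open>j\<close> at position \<open>i\<close>: the weights
  lie between 0 and 1 and have nontrivial limits.
\<close>

definition select_weight :: "nat \<Rightarrow> nat \<Rightarrow> nat \<Rightarrow> nat \<Rightarrow> nat \<Rightarrow> real" where
  "select_weight n s r i j = real n * real (card (select_at n s r i j)) / fact n"

lemma select_weight_bounds:
  assumes i: "i \<in> {1..n}"
  shows "0 \<le> select_weight n s r i j" "select_weight n s r i j \<le> 1"
proof -
  show "0 \<le> select_weight n s r i j" by (simp add: select_weight_def)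
  have "card (select_at n s r i j) * n \<le> fact n"
  proof (cases "j \<in> {1..n}")
    case True
    have "card (select_at n s r i j) \<le> card {X. X permutes {1..n} \<and> X i = j}"
      by (rule card_mono[OF finite_subset[OF _ finite_permutations[of "{1..n}"]]])
        (auto simp: select_at_def)
    then have "card (select_at n s r i j) * n \<le> card {X. X permutes {1..n} \<and> X i = j} * n"
      by (rule mult_le_mono1)
    then show ?thesis unfolding card_fixed_rank[OF i True] .
  next
    case False
    have "select_at n s r i j = {}"
      using False i by (auto simp: select_at_def dest: permutes_in_image)
    then show ?thesis by simp
  qed
  then have "real (card (select_at n s r i j) * n) \<le> real (fact n)" by (rule of_nat_mono)
  then show "select_weight n s r i j \<le> 1"
    by (simp add: select_weight_def mult.commute)
qed

lemma select_weight_eq: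
  assumes i: "i \<in> {1..n}" and j: "j \<in> {1..n}" and rs: "r \<le> s" "s < i"
  shows "select_weight n s r i j = real (s choose r) / real (i - 1 choose r)
    * (real (card {S. S \<subseteq> {1..n} - {i} \<and> card S = j - 1 \<and> card (S \<inter> {1..<i}) < r})
       / real (n - 1 choose (j - 1)))"
proof -
  define a b c d where "a = card (select_at n s r i j)"
    and "b = card {X. X permutes {1..n} \<and> X i = j \<and> relative_rank X i \<le> r}"
    and "c = card {X. X permutes {1..n} \<and> X i = j}"
    and "d = card {S. S \<subseteq> {1..n} - {i} \<and> card S = j - 1 \<and> card (S \<inter> {1..<i}) < r}"
  have 1: "real a * real (i - 1 choose r) = real b * real (s choose r)"
    using arg_cong[OF card_select_at[OF i rs, of j], of real] unfolding a_def b_def of_nat_mult .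
  have 2: "real b * real (n - 1 choose (j - 1)) = real c * real d"
    using arg_cong[OF card_fixed_rank_candidate[OF i j, of r], of real]
    unfolding b_def c_def d_def of_nat_mult .
  have 3: "real c * real n = fact n"
    using arg_cong[OF card_fixed_rank[OF i j], of real] unfolding c_def of_nat_mult of_nat_fact .
  have nz: "real (i - 1 choose r) \<noteq> 0" "real (n - 1 choose (j - 1)) \<noteq> 0" "real n \<noteq> 0"
    using i j rs by (auto simp: binomial_eq_0_iff)
  have c: "real c = fact n / real n" using 3 nz by (simp add: field_simps)
  have b: "real b = fact n / real n * real d / real (n - 1 choose (j - 1))"
    using 2 nz c by (simp add: field_simps)
  have a: "real a = real b * real (s choose r) / real (i - 1 choose r)"
    using 1 nz by (simp add: field_simps)
  show ?thesis
    unfolding select_weight_def a_def[symmetric] d_def[symmetric] a b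
    using nz by (simp add: mult.commute)
qed

text \<open>
  An object of absolute rank \<open>j \<le> r\<close> always has relative rank at most \<open>r\<close>, so only the waiting condition
  is left.
\<close>

lemma select_weight_small_rank:
  assumes i: "i \<in> {1..n}" and j: "j \<in> {1..n}" and rs: "r \<le> s" "s < i" and "j \<le> r"
  shows "select_weight n s r i j = real (s choose r) / real (i - 1 choose r)"
proof -
  have lt: "card (S \<inter> {1..<i}) < r" if "S \<subseteq> {1..n} - {i}" "card S = j - 1" for S
  proof -
    have "finite S" using that finite_subset by blast
    then have "card (S \<inter> {1..<i}) \<le> card S" by (intro card_mono) auto
    then show ?thesis using that j \<open>j \<le> r\<close> by auto
  qed
  then have "{S. S \<subseteq> {1..n} - {i} \<and> card S = j - 1 \<and> card (S \<inter> {1..<i}) < r}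
           = {S. S \<subseteq> {1..n} - {i} \<and> card S = j - 1}" by blast
  then have "card {S. S \<subseteq> {1..n} - {i} \<and> card S = j - 1 \<and> card (S \<inter> {1..<i}) < r}
      = (n - 1 choose (j - 1))"
    using i by (simp add: n_subsets)
  moreover have "(n - 1 choose (j - 1)) \<noteq> 0" using j by (auto simp: binomial_eq_0_iff)
  ultimately show ?thesis unfolding select_weight_eq[OF i j rs] by simp
qed

lemma select_weight_large_rank:
  assumes i: "i \<in> {1..n}" and j: "j \<in> {1..n}" and rs: "r \<le> s" "s < i" and "r < j"
  shows "select_weight n s r i j = real (s choose r) / real (i - 1 choose r)
    * (\<Sum>k=1..r. real (i - 1 choose (k - 1)) * real (n - i choose (j - k)) / real (n - 1 choose (j - 1)))"
proof -
  let ?P = "{1..<i}" and ?Q = "{i+1..n}"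
  have PQ: "{1..n} - {i} = ?P \<union> ?Q" using i by auto
  let ?C = "\<lambda>k. {S. S \<subseteq> ?P \<union> ?Q \<and> card S = j - 1 \<and> card (S \<inter> ?P) = k - 1}"
  have card_C: "card (?C k) = (i - 1 choose (k - 1)) * (n - i choose (j - k))" if k: "k \<in> {1..r}" for k
  proof -
    have "?P \<inter> ?Q = {}" by auto
    moreover have "j - 1 - (k - 1) = j - k" "k - 1 \<le> j - 1" using k \<open>r < j\<close> by auto
    ultimately show ?thesis
      using card_subsets_with_intersection[of ?P ?Q "k - 1" "j - 1"] by simp
  qed
  have "{S. S \<subseteq> ?P \<union> ?Q \<and> card S = j - 1 \<and> card (S \<inter> ?P) < r} = (\<Union>k\<in>{1..r}. ?C k)"
  proof (intro equalityI subsetI)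
    fix S assume S: "S \<in> {S. S \<subseteq> ?P \<union> ?Q \<and> card S = j - 1 \<and> card (S \<inter> ?P) < r}"
    then have "Suc (card (S \<inter> ?P)) \<in> {1..r}" by simp
    moreover have "S \<in> ?C (Suc (card (S \<inter> ?P)))" using S by simp
    ultimately show "S \<in> (\<Union>k\<in>{1..r}. ?C k)" by blast
  next
    fix S assume "S \<in> (\<Union>k\<in>{1..r}. ?C k)"
    then obtain k where k: "k \<in> {1..r}" and S: "S \<in> ?C k" by blast
    have "k - 1 < r" using k by auto
    then show "S \<in> {S. S \<subseteq> ?P \<union> ?Q \<and> card S = j - 1 \<and> card (S \<inter> ?P) < r}"
      using S by simp
  qed
  moreover have "card (\<Union>k\<in>{1..r}. ?C k) = (\<Sum>k=1..r. card (?C k))"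
  proof (rule card_UN_disjoint)
    show "\<forall>k\<in>{1..r}. finite (?C k)" by simp
    have "k = k'" if "k \<in> {1..r}" "k' \<in> {1..r}" "S \<in> ?C k" "S \<in> ?C k'" for k k' S
    proof -
      have "k - 1 = k' - 1" using that(3,4) by simp
      then show ?thesis using that(1,2) by auto
    qed
    then show "\<forall>k\<in>{1..r}. \<forall>k'\<in>{1..r}. k \<noteq> k' \<longrightarrow> ?C k \<inter> ?C k' = {}" by blast
  qed simp
  ultimately have "card {S. S \<subseteq> ?P \<union> ?Q \<and> card S = j - 1 \<and> card (S \<inter> ?P) < r}
      = (\<Sum>k=1..r. (i - 1 choose (k - 1)) * (n - i choose (j - k)))"
    using card_C by simp
  then show ?thesis unfolding select_weight_eq[OF i j rs] PQ
    by (simp add: sum_divide_distrib)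
qed

section \<open>The winning probability as a sum over the selected position\<close>

lemma slp_pick_eq_iff:
  assumes "i \<in> {s+1..n-1}"
  shows "slp_pick n s r X = i \<longleftrightarrow>
    relative_rank X i \<le> r \<and> (\<forall>k\<in>{s+1..i-1}. r < relative_rank X k)"
proof (cases "\<exists>i\<in>{s+1..n-1}. relative_rank X i \<le> r")
  case True
  let ?C = "\<lambda>i. i \<in> {s+1..n-1} \<and> relative_rank X i \<le> r"
  have pick: "slp_pick n s r X = (LEAST i. ?C i)" using True by (simp add: slp_pick_def)
  have C: "?C (LEAST i. ?C i)" using True by (metis (mono_tags, lifting) LeastI)
  show ?thesis
  proof
    assume eq: "slp_pick n s r X = i"
    have "r < relative_rank X k" if "k \<in> {s+1..i-1}" for k
    proof (rule ccontr)
      assume "\<not> r < relative_rank X k"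
      then have "?C k" using that assms by auto
      then have "i \<le> k" using eq unfolding pick using Least_le[of ?C k] by simp
      then show False using that assms by auto
    qed
    then show "relative_rank X i \<le> r \<and> (\<forall>k\<in>{s+1..i-1}. r < relative_rank X k)"
      using C eq pick by simp
  next
    assume *: "relative_rank X i \<le> r \<and> (\<forall>k\<in>{s+1..i-1}. r < relative_rank X k)"
    show "slp_pick n s r X = i" unfolding pick
    proof (rule Least_equality)
      show "?C i" using * assms by simp
      fix k assume k: "?C k"
      show "i \<le> k"
      proof (rule ccontr)
        assume "\<not> i \<le> k"
        then have "k \<in> {s+1..i-1}" using k by auto
        then have "r < relative_rank X k" using * by blast
        then show False using k by simp
      qed
    qed
  qed
next
  case False
  then have "slp_pick n s r X = n" by (simp add: slp_pick_def)
  then show ?thesis using False assms by auto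
qed

lemma slp_pick_cases: "slp_pick n s r X = n \<or> slp_pick n s r X \<in> {s+1..n-1}"
proof (cases "\<exists>i\<in>{s+1..n-1}. relative_rank X i \<le> r")
  case True
  then have "(LEAST i. i \<in> {s+1..n-1} \<and> relative_rank X i \<le> r) \<in> {s+1..n-1}"
    by (metis (mono_tags, lifting) LeastI)
  then show ?thesis using True by (simp add: slp_pick_def)
qed (simp add: slp_pick_def)

text \<open>
  The error accounts for wins at the last position, which require a rank of at most \<open>b\<close> there. The
  rank of the last object is uniform, so this event has probability at most \<open>b / n\<close>.
\<close>

lemma slp_win_prob_approx:
  assumes n: "1 \<le> n"
  shows "\<bar>slp_win_prob b n s r - (\<Sum>i\<in>{s+1..n-1}. \<Sum>j=1..b. select_weight n s r i j) / real n\<bar>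
         \<le> real b / real n"
proof -
  let ?perms = "{X :: nat \<Rightarrow> nat. X permutes {1..n}}"
  let ?I = "{s+1..n-1} \<times> {1..b}"
  let ?D = "\<lambda>(i, j). select_at n s r i j"
  let ?L = "{X \<in> ?perms. X (slp_pick n s r X) \<le> b \<and> slp_pick n s r X = n}"
  let ?W = "{X \<in> ?perms. X (slp_pick n s r X) \<le> b}"
  have finp: "finite ?perms" by (simp add: finite_permutations)
  have nep: "?perms \<noteq> {}" using permutes_id by blast
  have cardp: "card ?perms = fact n" by (simp add: card_permutations)
  have W: "?W = (\<Union>x\<in>?I. ?D x) \<union> ?L"
  proof safe
    fix X assume X: "X permutes {1..n}" "X (slp_pick n s r X) \<le> b" "X \<notin> (\<Union>x\<in>?I. ?D x)"
    show "slp_pick n s r X = n"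
    proof (rule ccontr)
      assume "slp_pick n s r X \<noteq> n"
      then have i: "slp_pick n s r X \<in> {s+1..n-1}" using slp_pick_cases by blast
      then have "X (slp_pick n s r X) \<in> {1..n}"
        using permutes_in_image[OF X(1), of "slp_pick n s r X"] by auto
      then have "(slp_pick n s r X, X (slp_pick n s r X)) \<in> ?I" using X i by auto
      moreover have "X \<in> ?D (slp_pick n s r X, X (slp_pick n s r X))"
        using slp_pick_eq_iff[OF i, of r X] X by (simp add: select_at_def)
      ultimately show False using X(3) by blast
    qed
  next
    fix X i j assume ij: "i \<in> {s+1..n-1}" "j \<in> {1..b}" and X: "X \<in> select_at n s r i j"
    have "slp_pick n s r X = i" using slp_pick_eq_iff[OF ij(1), of r X] X by (simp add: select_at_def)
    then show "X (slp_pick n s r X) \<le> b" using X ij by (simp add: select_at_def)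
    show "X permutes {1..n}" using X by (simp add: select_at_def)
  qed
  have pickD: "slp_pick n s r X = i" if "X \<in> select_at n s r i j" "i \<in> {s+1..n-1}" for X i j
    using slp_pick_eq_iff[OF that(2), of r X] that by (simp add: select_at_def)
  have disj: "(\<Union>x\<in>?I. ?D x) \<inter> ?L = {}"
    using pickD by fastforce
  have "card (\<Union>x\<in>?I. ?D x) = (\<Sum>x\<in>?I. card (?D x))"
  proof (rule card_UN_disjoint)
    show "\<forall>x\<in>?I. \<forall>y\<in>?I. x \<noteq> y \<longrightarrow> ?D x \<inter> ?D y = {}"
    proof (intro ballI impI, rule ccontr)
      fix x y assume xy: "x \<in> ?I" "y \<in> ?I" "x \<noteq> y" "?D x \<inter> ?D y \<noteq> {}"
      then obtain X i j i' j' where *: "x = (i, j)" "y = (i', j')"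
        "X \<in> select_at n s r i j" "X \<in> select_at n s r i' j'" by (cases x; cases y) auto
      then have "i = i'" using pickD xy by blast
      then have "j = j'" using * by (simp add: select_at_def)
      then show False using \<open>i = i'\<close> xy * by simp
    qed
  qed (auto simp: finite_select_at)
  then have cardD: "card (\<Union>x\<in>?I. ?D x) = (\<Sum>i\<in>{s+1..n-1}. \<Sum>j=1..b. card (select_at n s r i j))"
    by (simp add: sum.cartesian_product split_def)
  have cardW: "card ?W = (\<Sum>i\<in>{s+1..n-1}. \<Sum>j=1..b. card (select_at n s r i j)) + card ?L"
    unfolding W cardD[symmetric]
    by (rule card_Un_disjoint[OF _ _ disj]) (use finp in \<open>auto simp: finite_select_at\<close>)
  have "?L \<subseteq> (\<Union>j\<in>{1..b} \<inter> {1..n}. {X. X permutes {1..n} \<and> X n = j})"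
  proof
    fix X assume X: "X \<in> ?L"
    then have "X n \<in> {1..n}" using permutes_in_image[of X "{1..n}" n] n by simp
    then show "X \<in> (\<Union>j\<in>{1..b} \<inter> {1..n}. {X. X permutes {1..n} \<and> X n = j})" using X by auto
  qed
  then have "card ?L \<le> card (\<Union>j\<in>{1..b} \<inter> {1..n}. {X. X permutes {1..n} \<and> X n = j})"
    by (rule card_mono[rotated]) (auto intro: finite_subset[OF _ finp])
  also have "\<dots> \<le> (\<Sum>j\<in>{1..b} \<inter> {1..n}. card {X. X permutes {1..n} \<and> X n = j})"
    by (rule card_UN_le) simp
  finally have "card ?L * n \<le> (\<Sum>j\<in>{1..b} \<inter> {1..n}. card {X. X permutes {1..n} \<and> X n = j}) * n"
    by simp
  also have "\<dots> = (\<Sum>j\<in>{1..b} \<inter> {1..n}. fact n)"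
    unfolding sum_distrib_right using n by (intro sum.cong card_fixed_rank) auto
  also have "\<dots> \<le> b * fact n"
  proof -
    have "card ({1..b} \<inter> {1..n}) \<le> card {1..b}" by (rule card_mono) auto
    then show ?thesis by simp
  qed
  finally have "real (card ?L * n) \<le> real (b * fact n)" by (rule of_nat_mono)
  then have L: "real (card ?L) / fact n \<le> real b / real n"
    using n by (simp add: field_simps)
  have "slp_win_prob b n s r = measure_pmf.prob (pmf_of_set ?perms) {X. X (slp_pick n s r X) \<le> b}"
    by (simp add: slp_win_prob_def arrival_pmf_def)
  also have "\<dots> = real (card ?W) / fact n"
    using measure_pmf_of_set[OF nep finp] cardp by (simp add: Int_def)
  also have "\<dots> = (\<Sum>i\<in>{s+1..n-1}. \<Sum>j=1..b. real (card (select_at n s r i j)) / fact n) + real (card ?L) / fact n"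
    unfolding cardW by (simp add: add_divide_distrib sum_divide_distrib)
  also have "(\<Sum>i\<in>{s+1..n-1}. \<Sum>j=1..b. real (card (select_at n s r i j)) / fact n)
      = (\<Sum>i\<in>{s+1..n-1}. \<Sum>j=1..b. select_weight n s r i j) / real n"
    unfolding sum_divide_distrib using n by (intro sum.cong refl) (simp add: select_weight_def)
  finally show ?thesis using L by simp
qed

section \<open>Limits of binomial coefficients and Riemann sums\<close>

lemma binomial_over_power_tendsto:
  fixes a :: "nat \<Rightarrow> nat"
  assumes "(\<lambda>n. real (a n) / real n) \<longlonglongrightarrow> c"
  shows "(\<lambda>n. real (a n choose k) / real n ^ k) \<longlonglongrightarrow> c ^ k / fact k"
proof -
  have "(\<lambda>n. real (a n choose k) / real n ^ k)
      = (\<lambda>n. (\<Prod>q<k. real (a n) / real n - real q / real n) / fact k)"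
  proof
    fix n
    have "real (a n choose k) = (\<Prod>q<k. real (a n) - real q) / fact k"
      by (simp add: binomial_gbinomial gbinomial_prod_rev atLeast0LessThan)
    then show "real (a n choose k) / real n ^ k = (\<Prod>q<k. real (a n) / real n - real q / real n) / fact k"
      by (simp add: diff_divide_distrib[symmetric] prod_dividef)
  qed
  moreover have "(\<lambda>n. (\<Prod>q<k. real (a n) / real n - real q / real n) / fact k)
      \<longlonglongrightarrow> (\<Prod>q<k. c - 0) / fact k"
    by (intro tendsto_divide tendsto_prod tendsto_diff assms tendsto_const lim_const_over_n) simp
  ultimately show ?thesis by simp
qed

text \<open>
  The sum is the integral over the unit interval of the step function with value \<open>f n i\<close> on
  \<open>{(i-1)/n<..i/n}\<close>, whose value at \<open>x\<close> is \<open>f n \<lceil>n x\<rceil>\<close>. Convergence almost everywhere suffices, which allows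
  weights with a jump at a limiting threshold.
\<close>

lemma riemann_sum_tendsto:
  fixes f :: "nat \<Rightarrow> nat \<Rightarrow> real" and g :: "real \<Rightarrow> real"
  assumes bound: "\<And>n i. i \<in> {1..n} \<Longrightarrow> \<bar>f n i\<bar> \<le> B"
    and g: "g \<in> borel_measurable borel"
    and lim: "AE x in lborel. x \<in> {0<..<1} \<longrightarrow> (\<lambda>n. f n (nat \<lceil>real n * x\<rceil>)) \<longlonglongrightarrow> g x"
  shows "(\<lambda>n. (\<Sum>i=1..n. f n i) / real n) \<longlonglongrightarrow> (LINT x:{0<..<1}|lborel. g x)"
proof -
  define J where "J n i = {(real i - 1) / real n<..real i / real n}" for n i :: nat
  define u where "u n x = (\<Sum>i=1..n. indicator (J n i) x *\<^sub>R f n i)" for n x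
  have J_iff: "x \<in> J n i \<longleftrightarrow> i = nat \<lceil>real n * x\<rceil>" if "i \<ge> 1" "n \<ge> 1" for n i x
  proof -
    have "x \<in> J n i \<longleftrightarrow> real i - 1 < real n * x \<and> real n * x \<le> real i"
      using that by (auto simp: J_def field_simps)
    also have "\<dots> \<longleftrightarrow> \<lceil>real n * x\<rceil> = int i" by (simp add: ceiling_eq_iff)
    also have "\<dots> \<longleftrightarrow> i = nat \<lceil>real n * x\<rceil>" using that by auto
    finally show ?thesis .
  qed
  have u_eq: "u n x = (if nat \<lceil>real n * x\<rceil> \<in> {1..n} then f n (nat \<lceil>real n * x\<rceil>) else 0)" for n x
  proof (cases "n = 0")
    case False
    have "u n x = (\<Sum>i=1..n. if i = nat \<lceil>real n * x\<rceil> then f n i else 0)"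
      unfolding u_def using False by (intro sum.cong refl) (auto simp: J_iff indicator_def)
    then show ?thesis by simp
  qed (simp add: u_def)
  have in01: "nat \<lceil>real n * x\<rceil> \<in> {1..n} \<longleftrightarrow> x \<in> {0<..1}" if "n \<ge> 1" for n x
  proof -
    have "nat c \<in> {1..n} \<longleftrightarrow> 0 < c \<and> c \<le> int n" for c by auto
    then have "nat \<lceil>real n * x\<rceil> \<in> {1..n} \<longleftrightarrow> 0 < \<lceil>real n * x\<rceil> \<and> \<lceil>real n * x\<rceil> \<le> int n" .
    also have "\<dots> \<longleftrightarrow> 0 < real n * x \<and> real n * x \<le> real n" by (simp add: ceiling_le_iff less_ceiling_iff)
    also have "\<dots> \<longleftrightarrow> x \<in> {0<..1}" using that by (auto simp: zero_less_mult_iff)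
    finally show ?thesis .
  qed
  have u_inside: "u n x = f n (nat \<lceil>real n * x\<rceil>)" if "n \<ge> 1" "x \<in> {0<..1}" for n x
    using that in01[OF that(1), of x] by (simp only: u_eq if_True)
  have u_outside: "u n x = 0" if "x \<notin> {0<..1}" for n x
  proof (cases "n = 0")
    case False
    then have "nat \<lceil>real n * x\<rceil> \<notin> {1..n}" using that in01[of n x] by simp
    then show ?thesis by (simp only: u_eq if_False)
  qed (simp add: u_def)
  have int_u: "has_bochner_integral lborel (u n) ((\<Sum>i=1..n. f n i) / real n)" for n
  proof -
    have "has_bochner_integral lborel (u n) (\<Sum>i=1..n. (1 / real n) *\<^sub>R f n i)"
      unfolding u_def
    proof (intro has_bochner_integral_sum has_bochner_integral_scaleR_left)
      fix i assume i: "i \<in> {1..n}"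
      then have "emeasure lborel (J n i) = ennreal (1 / real n)"
        by (simp add: J_def divide_right_mono diff_divide_distrib)
      then show "has_bochner_integral lborel (indicator (J n i) :: real \<Rightarrow> real) (1 / real n)"
        using has_bochner_integral_real_indicator[of "J n i" lborel]
        by (simp add: J_def measure_def divide_right_mono)
    qed
    then show ?thesis by (simp add: sum_divide_distrib)
  qed
  have B: "0 \<le> B" using bound[of 1 1] by auto
  have "(\<lambda>n. integral\<^sup>L lborel (u n)) \<longlonglongrightarrow> (\<integral>x. indicator {0<..<1} x *\<^sub>R g x \<partial>lborel)"
  proof (rule integral_dominated_convergence[where w = "\<lambda>x. indicator {0<..1} x *\<^sub>R B"])
    show "(\<lambda>x. indicator {0<..<1} x *\<^sub>R g x) \<in> borel_measurable lborel" using g by simp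
    show "u n \<in> borel_measurable lborel" for n
      using int_u[of n] by (intro borel_measurable_integrable integrable.intros)
    show "integrable lborel (\<lambda>x. indicator {0<..1::real} x *\<^sub>R B)"
      by (intro integrable_scaleR_left) simp
    show "AE x in lborel. norm (u n x) \<le> indicator {0<..1} x *\<^sub>R B" for n
    proof (cases "n = 0")
      case False
      have "norm (u n x) \<le> indicator {0<..1} x *\<^sub>R B" for x
      proof (cases "x \<in> {0<..1}")
        case True
        then have "nat \<lceil>real n * x\<rceil> \<in> {1..n}" using in01[of n x] False by simp
        then show ?thesis using True False bound by (simp add: u_inside)
      next
        case x: False
        then show ?thesis by (simp add: u_outside[OF x])
      qed
      then show ?thesis by simp
    qed (use B in \<open>simp add: u_def\<close>)
    show "AE x in lborel. (\<lambda>n. u n x) \<longlonglongrightarrow> indicator {0<..<1} x *\<^sub>R g x"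
      using lim AE_lborel_singleton[of 1]
    proof eventually_elim
      case (elim x)
      show ?case
      proof (cases "x \<in> {0<..<1}")
        case True
        have "eventually (\<lambda>n. f n (nat \<lceil>real n * x\<rceil>) = u n x) sequentially"
          using eventually_ge_at_top[of 1] by eventually_elim (use True u_inside in simp)
        then have "(\<lambda>n. u n x) \<longlonglongrightarrow> g x"
          using elim(1) True by (auto intro: Lim_transform_eventually)
        then show ?thesis using True by simp
      next
        case False
        then have x: "x \<notin> {0<..1}" using elim(2) by auto
        then show ?thesis using False by (simp add: u_outside[OF x])
      qed
    qed
  qed
  moreover have "integral\<^sup>L lborel (u n) = (\<Sum>i=1..n. f n i) / real n" for n
    using int_u by (rule has_bochner_integral_integral_eq)
  ultimately show ?thesis by (simp add: set_lebesgue_integral_def)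
qed

section \<open>The limiting winning probability\<close>

text \<open>
  Each binomial coefficient is normalised by the matching power of \<open>n\<close>. The powers cancel in every
  weight because \<open>(k - 1) + (j - k) = j - 1\<close>, and the factorials left over combine to
  \<open>(j - 1 choose (k - 1))\<close>.
\<close>

lemma select_weight_sum_tendsto:
  fixes s i :: "nat \<Rightarrow> nat" and b r :: nat and \<alpha> x :: real
  assumes r: "r \<in> {1..b}" and \<alpha>: "0 < \<alpha>" "\<alpha> < x" "x < 1"
    and s: "(\<lambda>n. real (s n) / real n) \<longlonglongrightarrow> \<alpha>" and i: "(\<lambda>n. real (i n) / real n) \<longlonglongrightarrow> x"
  shows "(\<lambda>n. \<Sum>j=1..b. select_weight n (s n) r (i n) j) \<longlonglongrightarrow>
    \<alpha> ^ r * (1 / x ^ r * (real r + (\<Sum>j=r+1..b. \<Sum>k=1..r.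
                real ((j - 1) choose (k - 1)) * x ^ (k - 1) * (1 - x) ^ (j - k))))"
proof -
  have x0: "0 < x" using \<alpha> by simp
  have ev_s: "eventually (\<lambda>n. r \<le> s n) sequentially"
  proof -
    have "eventually (\<lambda>n. \<alpha> / 2 < real (s n) / real n) sequentially"
      using s \<alpha> by (intro order_tendstoD(1)) auto
    moreover have "eventually (\<lambda>n. 2 * real r / \<alpha> \<le> real n) sequentially"
      by real_asymp
    ultimately show ?thesis using eventually_gt_at_top[of 0]
    proof eventually_elim
      case (elim n)
      then have "real r \<le> \<alpha> / 2 * real n" "\<alpha> / 2 * real n < real (s n)"
        using \<alpha> by (auto simp: field_simps)
      then show ?case by linarith
    qed
  qed
  have ev_si: "eventually (\<lambda>n. s n < i n) sequentially"
  proof -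
    have "eventually (\<lambda>n. 0 < real (i n) / real n - real (s n) / real n) sequentially"
      by (rule order_tendstoD(1)[OF tendsto_diff[OF i s]]) (use \<alpha> in simp)
    then show ?thesis by eventually_elim (auto simp: diff_divide_distrib[symmetric] zero_less_divide_iff)
  qed
  have ev_in: "eventually (\<lambda>n. i n < n) sequentially"
  proof -
    have "eventually (\<lambda>n. real (i n) / real n < 1) sequentially"
      using i \<alpha> by (intro order_tendstoD(2)) auto
    then show ?thesis using eventually_gt_at_top[of 0]
      by eventually_elim (auto simp: field_simps)
  qed
  have n_ne: "eventually (\<lambda>n. real n \<noteq> 0) sequentially"
    using eventually_gt_at_top[of 0] by eventually_elim auto
  have lim_i1: "(\<lambda>n. real (i n - 1) / real n) \<longlonglongrightarrow> x"
  proof -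
    have "(\<lambda>n. real (i n) / real n - 1 / real n) \<longlonglongrightarrow> x - 0"
      by (intro tendsto_diff i lim_const_over_n)
    moreover have "eventually (\<lambda>n. real (i n) / real n - 1 / real n = real (i n - 1) / real n) sequentially"
      using ev_si by eventually_elim (auto simp: diff_divide_distrib[symmetric] of_nat_diff)
    ultimately show ?thesis by (auto intro: Lim_transform_eventually)
  qed
  have lim_ni: "(\<lambda>n. real (n - i n) / real n) \<longlonglongrightarrow> 1 - x"
  proof -
    have "(\<lambda>n. 1 - real (i n) / real n) \<longlonglongrightarrow> 1 - x"
      by (intro tendsto_diff i tendsto_const)
    moreover have "eventually (\<lambda>n. 1 - real (i n) / real n = real (n - i n) / real n) sequentially"
      using ev_in by eventually_elim (auto simp: field_simps of_nat_diff)
    ultimately show ?thesis by (auto intro: Lim_transform_eventually)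
  qed
  have lim_n1: "(\<lambda>n. real (n - 1) / real n) \<longlonglongrightarrow> 1"
    by real_asymp
  have lim0: "(\<lambda>n. real (s n choose r) / real (i n - 1 choose r)) \<longlonglongrightarrow> \<alpha> ^ r * (1 / x ^ r)"
  proof -
    have "(\<lambda>n. (real (s n choose r) / real n ^ r) / (real (i n - 1 choose r) / real n ^ r))
        \<longlonglongrightarrow> (\<alpha> ^ r / fact r) / (x ^ r / fact r)"
      using x0 by (intro tendsto_divide binomial_over_power_tendsto s lim_i1) auto
    then have "(\<lambda>n. (real (s n choose r) / real n ^ r) / (real (i n - 1 choose r) / real n ^ r))
        \<longlonglongrightarrow> \<alpha> ^ r * (1 / x ^ r)" by simp
    then show ?thesis
      by (rule Lim_transform_eventually) (use n_ne in eventually_elim, simp)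
  qed
  have limh: "(\<lambda>n. real (i n - 1 choose (k - 1)) * real (n - i n choose (j - k)) / real (n - 1 choose (j - 1)))
      \<longlonglongrightarrow> real ((j - 1) choose (k - 1)) * x ^ (k - 1) * (1 - x) ^ (j - k)"
    if k: "k \<in> {1..r}" and j: "j \<in> {r+1..b}" for j k
  proof -
    have "j - 1 = (k - 1) + (j - k)" using j k by auto
    then have pow: "real n ^ (j - 1) = real n ^ (k - 1) * real n ^ (j - k)" for n
      by (simp only: power_add)
    have "(\<lambda>n. (real (i n - 1 choose (k - 1)) / real n ^ (k - 1)) * (real (n - i n choose (j - k)) / real n ^ (j - k))
          / (real (n - 1 choose (j - 1)) / real n ^ (j - 1)))
        \<longlonglongrightarrow> (x ^ (k - 1) / fact (k - 1)) * ((1 - x) ^ (j - k) / fact (j - k)) / (1 ^ (j - 1) / fact (j - 1))"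
      by (intro tendsto_divide tendsto_mult binomial_over_power_tendsto lim_i1 lim_ni lim_n1) auto
    moreover have "(x ^ (k - 1) / fact (k - 1)) * ((1 - x) ^ (j - k) / fact (j - k)) / (1 ^ (j - 1) / fact (j - 1))
        = real ((j - 1) choose (k - 1)) * x ^ (k - 1) * (1 - x) ^ (j - k)"
    proof -
      have "j - 1 - (k - 1) = j - k" "k - 1 \<le> j - 1" using j k by auto
      then show ?thesis using binomial_fact[of "k - 1" "j - 1", where 'a = real] by simp
    qed
    ultimately have "(\<lambda>n. (real (i n - 1 choose (k - 1)) / real n ^ (k - 1)) * (real (n - i n choose (j - k)) / real n ^ (j - k))
          / (real (n - 1 choose (j - 1)) / real n ^ (j - 1)))
        \<longlonglongrightarrow> real ((j - 1) choose (k - 1)) * x ^ (k - 1) * (1 - x) ^ (j - k)" by simp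
    then show ?thesis
    proof (rule Lim_transform_eventually)
      show "eventually (\<lambda>n. (real (i n - 1 choose (k - 1)) / real n ^ (k - 1)) * (real (n - i n choose (j - k)) / real n ^ (j - k))
          / (real (n - 1 choose (j - 1)) / real n ^ (j - 1))
          = real (i n - 1 choose (k - 1)) * real (n - i n choose (j - k)) / real (n - 1 choose (j - 1))) sequentially"
        unfolding pow using n_ne by eventually_elim simp
    qed
  qed
  have "(\<lambda>n. real (s n choose r) / real (i n - 1 choose r) * (real r + (\<Sum>j=r+1..b. \<Sum>k=1..r.
        real (i n - 1 choose (k - 1)) * real (n - i n choose (j - k)) / real (n - 1 choose (j - 1)))))
      \<longlonglongrightarrow> (\<alpha> ^ r * (1 / x ^ r)) * (real r + (\<Sum>j=r+1..b. \<Sum>k=1..r.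
                real ((j - 1) choose (k - 1)) * x ^ (k - 1) * (1 - x) ^ (j - k)))"
    by (intro tendsto_mult lim0 tendsto_add tendsto_const tendsto_sum limh)
  moreover have "eventually (\<lambda>n. real (s n choose r) / real (i n - 1 choose r) * (real r + (\<Sum>j=r+1..b. \<Sum>k=1..r.
        real (i n - 1 choose (k - 1)) * real (n - i n choose (j - k)) / real (n - 1 choose (j - 1))))
      = (\<Sum>j=1..b. select_weight n (s n) r (i n) j)) sequentially"
    using ev_s ev_si ev_in eventually_ge_at_top[of b]
  proof eventually_elim
    case (elim n)
    let ?q = "real (s n choose r) / real (i n - 1 choose r)"
    have i: "i n \<in> {1..n}" using elim by auto
    have "{1..b} = {1..r} \<union> {r+1..b}" using r by auto
    then have "(\<Sum>j=1..b. select_weight n (s n) r (i n) j)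
        = (\<Sum>j=1..r. select_weight n (s n) r (i n) j) + (\<Sum>j=r+1..b. select_weight n (s n) r (i n) j)"
      by (simp add: sum.union_disjoint[symmetric])
    also have "(\<Sum>j=1..r. select_weight n (s n) r (i n) j) = (\<Sum>j=1..r. ?q)"
      using elim r by (intro sum.cong refl select_weight_small_rank i) auto
    also have "(\<Sum>j=r+1..b. select_weight n (s n) r (i n) j)
        = (\<Sum>j=r+1..b. ?q * (\<Sum>k=1..r. real (i n - 1 choose (k - 1)) * real (n - i n choose (j - k))
            / real (n - 1 choose (j - 1))))"
      using elim by (intro sum.cong refl select_weight_large_rank i) auto
    finally show ?case by (simp add: sum_distrib_left distrib_left)
  qed
  ultimately show ?thesis by (simp add: Lim_transform_eventually mult.assoc)
qed

theorem theorem4: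
  fixes b r :: nat and \<alpha> :: real and s :: "nat \<Rightarrow> int"
  assumes "1 \<le> b" and "r \<in> {1..b}" and "0 < \<alpha>" and "\<alpha> < 1"
    and "(\<lambda>n. real_of_int (s n) - \<alpha> * real n) \<in> o(\<lambda>n. real n)"
  shows "(\<lambda>n. slp_win_prob b n (nat (s n)) r) \<longlonglongrightarrow>
           \<alpha> ^ r * integral {\<alpha>..1} (\<lambda>x. 1 / x ^ r *
             (real r + (\<Sum>j=r+1..b. \<Sum>k=1..r.
                real ((j - 1) choose (k - 1)) * x ^ (k - 1) * (1 - x) ^ (j - k))))"
proof -
  define t where "t n = nat (s n)" for n
  define G where "G x = 1 / x ^ r * (real r + (\<Sum>j=r+1..b. \<Sum>k=1..r.
      real ((j - 1) choose (k - 1)) * x ^ (k - 1) * (1 - x) ^ (j - k)))" for x :: real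
  define f where "f n i = (if t n < i \<and> i < n then \<Sum>j=1..b. select_weight n (t n) r i j else 0)" for n i
  define g where "g x = indicator {\<alpha>..1} x *\<^sub>R (\<alpha> ^ r * G x)" for x
  have t: "(\<lambda>n. real (t n) / real n) \<longlonglongrightarrow> \<alpha>"
  proof -
    (* Truncating a negative threshold to 0 is harmless in the limit, since \<alpha> is positive. *)
    have "(\<lambda>n. (real_of_int (s n) - \<alpha> * real n) / real n) \<longlonglongrightarrow> 0"
      using assms(5) by (rule smalloD_tendsto)
    then have "(\<lambda>n. max 0 ((real_of_int (s n) - \<alpha> * real n) / real n + \<alpha>)) \<longlonglongrightarrow> max 0 (0 + \<alpha>)"
      by (intro tendsto_max tendsto_add tendsto_const)
    moreover have "eventually (\<lambda>n. max 0 ((real_of_int (s n) - \<alpha> * real n) / real n + \<alpha>) = real (t n) / real n) sequentially"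
      using eventually_gt_at_top[of 0]
      by eventually_elim (auto simp: t_def max_def field_simps)
    ultimately show ?thesis using assms(3) by (auto intro: Lim_transform_eventually)
  qed
  have contG: "continuous_on {\<alpha>..1} G"
    unfolding G_def using assms(3) by (intro continuous_intros) auto
  have g_meas: "g \<in> borel_measurable borel"
    unfolding g_def by (intro borel_measurable_continuous_on_indicator continuous_intros contG) auto
  have "(\<lambda>n. (\<Sum>i=1..n. f n i) / real n) \<longlonglongrightarrow> (LINT x:{0<..<1}|lborel. g x)"
  proof (rule riemann_sum_tendsto[where B = "real b"])
    fix n i :: nat assume i: "i \<in> {1..n}"
    have "(\<Sum>j=1..b. select_weight n (t n) r i j) \<le> (\<Sum>j=1..b. 1)"
      by (intro sum_mono select_weight_bounds i)
    moreover have "0 \<le> (\<Sum>j=1..b. select_weight n (t n) r i j)"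
      by (intro sum_nonneg select_weight_bounds i)
    ultimately show "\<bar>f n i\<bar> \<le> real b" by (simp add: f_def)
  next
    show "g \<in> borel_measurable borel" by (rule g_meas)
    show "AE x in lborel. x \<in> {0<..<1} \<longrightarrow> (\<lambda>n. f n (nat \<lceil>real n * x\<rceil>)) \<longlonglongrightarrow> g x"
      \<comment> \<open>At \<open>x = \<alpha>\<close> the position \<open>\<lceil>n x\<rceil>\<close> may fall on either side of the threshold, so the limit need not exist.\<close>
      using AE_lborel_singleton[of \<alpha>]
    proof eventually_elim
      case (elim x)
      show ?case
      proof
        assume x: "x \<in> {0<..<1}"
        define i where "i n = nat \<lceil>real n * x\<rceil>" for n
        have i: "(\<lambda>n. real (i n) / real n) \<longlonglongrightarrow> x"
        proof (rule tendsto_sandwich[of "\<lambda>n. x" _ _ "\<lambda>n. x + 1 / real n"])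
          have le: "real n * x \<le> real (i n)" "real (i n) \<le> real n * x + 1" for n
            using x unfolding i_def by (auto simp: of_nat_nat)
          show "eventually (\<lambda>n. x \<le> real (i n) / real n) sequentially"
            using eventually_gt_at_top[of 0] by eventually_elim (use le in \<open>auto simp: field_simps\<close>)
          show "eventually (\<lambda>n. real (i n) / real n \<le> x + 1 / real n) sequentially"
            using eventually_gt_at_top[of 0] by eventually_elim (use le in \<open>auto simp: field_simps\<close>)
          have "(\<lambda>n. x + 1 / real n) \<longlonglongrightarrow> x + 0"
            by (intro tendsto_add tendsto_const lim_const_over_n)
          then show "(\<lambda>n. x + 1 / real n) \<longlonglongrightarrow> x" by simp
        qed simp
        have diff: "(\<lambda>n. real (i n) / real n - real (t n) / real n) \<longlonglongrightarrow> x - \<alpha>"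
          by (intro tendsto_diff i t)
        show "(\<lambda>n. f n (nat \<lceil>real n * x\<rceil>)) \<longlonglongrightarrow> g x"
        proof (cases "x < \<alpha>")
          case True
          have "eventually (\<lambda>n. real (i n) / real n - real (t n) / real n < 0) sequentially"
            using diff True by (intro order_tendstoD(2)) auto
          then have "eventually (\<lambda>n. 0 = f n (i n)) sequentially"
            by eventually_elim (auto simp: f_def diff_divide_distrib[symmetric] divide_less_0_iff)
          then have "(\<lambda>n. f n (i n)) \<longlonglongrightarrow> 0" by (rule Lim_transform_eventually[OF tendsto_const])
          then show ?thesis using True by (simp add: i_def g_def)
        next
          case False
          then have \<alpha>x: "\<alpha> < x" using elim by simp
          have "eventually (\<lambda>n. 0 < real (i n) / real n - real (t n) / real n) sequentially"
            using diff \<alpha>x by (intro order_tendstoD(1)) auto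
          moreover have "eventually (\<lambda>n. real (i n) / real n < 1) sequentially"
            using i x by (intro order_tendstoD(2)) auto
          ultimately have "eventually (\<lambda>n. (\<Sum>j=1..b. select_weight n (t n) r (i n) j) = f n (i n)) sequentially"
            using eventually_gt_at_top[of 0]
            by eventually_elim (auto simp: f_def diff_divide_distrib[symmetric] zero_less_divide_iff divide_less_eq)
          moreover have "(\<lambda>n. \<Sum>j=1..b. select_weight n (t n) r (i n) j) \<longlonglongrightarrow> \<alpha> ^ r * G x"
            unfolding G_def using x by (intro select_weight_sum_tendsto assms(2,3) \<alpha>x t i) auto
          ultimately have "(\<lambda>n. f n (i n)) \<longlonglongrightarrow> \<alpha> ^ r * G x" by (rule Lim_transform_eventually[rotated])
          then show ?thesis using \<alpha>x x by (simp add: i_def g_def)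
        qed
      qed
    qed
  qed
  moreover have "(LINT x:{0<..<1}|lborel. g x) = \<alpha> ^ r * integral {\<alpha>..1} G"
  proof -
    have "(LINT x:{0<..<1}|lborel. g x) = (LINT x:{\<alpha>..1}|lborel. \<alpha> ^ r * G x)"
      unfolding set_lebesgue_integral_def
    proof (rule integral_cong_AE)
      show "AE x in lborel. indicator {0<..<1} x *\<^sub>R g x = indicator {\<alpha>..1} x *\<^sub>R (\<alpha> ^ r * G x)"
        using AE_lborel_singleton[of 1] by eventually_elim (use assms(3) in \<open>auto simp: g_def indicator_def\<close>)
      show "(\<lambda>x. indicator {0<..<1} x *\<^sub>R g x) \<in> borel_measurable lborel"
        using g_meas by simp
      show "(\<lambda>x. indicator {\<alpha>..1} x *\<^sub>R (\<alpha> ^ r * G x)) \<in> borel_measurable lborel"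
        using g_meas unfolding g_def by simp
    qed
    also have "\<dots> = integral {\<alpha>..1} (\<lambda>x. \<alpha> ^ r * G x)"
      by (intro set_borel_integral_eq_integral borel_integrable_atLeastAtMost' continuous_intros contG)
    finally show ?thesis by simp
  qed
  moreover have "(\<Sum>i=1..n. f n i) = (\<Sum>i\<in>{t n+1..n-1}. \<Sum>j=1..b. select_weight n (t n) r i j)" for n
    by (rule sum.mono_neutral_cong_right) (auto simp: f_def)
  ultimately have main: "(\<lambda>n. (\<Sum>i\<in>{t n+1..n-1}. \<Sum>j=1..b. select_weight n (t n) r i j) / real n)
      \<longlonglongrightarrow> \<alpha> ^ r * integral {\<alpha>..1} G" by simp
  have "(\<lambda>n. slp_win_prob b n (t n) r - (\<Sum>i\<in>{t n+1..n-1}. \<Sum>j=1..b. select_weight n (t n) r i j) / real n)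
      \<longlonglongrightarrow> 0"
  proof (rule Lim_null_comparison[OF _ lim_const_over_n[of "real b"]])
    show "eventually (\<lambda>n. norm (slp_win_prob b n (t n) r
        - (\<Sum>i\<in>{t n+1..n-1}. \<Sum>j=1..b. select_weight n (t n) r i j) / real n) \<le> real b / real n) sequentially"
      using eventually_ge_at_top[of 1] by eventually_elim (simp only: real_norm_def slp_win_prob_approx)
  qed
  from tendsto_add[OF this main]
  have "(\<lambda>n. slp_win_prob b n (nat (s n)) r) \<longlonglongrightarrow> \<alpha> ^ r * integral {\<alpha>..1} G"
    by (simp add: t_def)
  then show ?thesis unfolding G_def[abs_def] .
qed

end
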